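(* Consider a pHDAE on an open set $\mathcal X\subseteq\mathbb R^n$ with coefficients $E,J,R,B,z$ and Hamiltonian $\mathcal H$, let $(\overline E,\overline z)$ be a discrete gradient pair for $(\mathcal H,E,z)$, and let $\overline J,\overline R,\overline B$ be consistent approximations of $J,R,B$ such that $\overline J=-\overline J^\top$ and $\overline R=\overline R^\top\succeq0$ pointwise. Let $(\varphi,U)$ be an invertible system transformation with $\varphi:\widetilde{\mathcal X}\to\mathcal X$, let $\overline{\mathrm D}\varphi$ be a discrete Jacobian for $\varphi$, and let $\overline U$ be a pointwise invertible consistent approximation of $U$. For $\tilde x,\tilde x'\in\widetilde{\mathcal X}$, writing $(\overline G\circ\varphi)(\tilde x,\tilde x')=\overline G(\varphi(\tilde x),\varphi(\tilde x'))$, set $$\widehat E=\overline U^\top(\overline E\circ\varphi)\overline{\mathrm D}\varphi,\quad \hat z=\overline U^{-1}(\overline z\circ\varphi),\quad \widehat J=\overline U^\top(\overline J\circ\varphi)\overline U,\quad \widehat R=\overline U^\top(\overline R\circ\varphi)\overline U,\quad \widehat B=\overline U^\top(\overline B\circ\varphi).$$ Then $\widehat J,\widehat R,\widehat B$ are consistent approximations of the coefficients $\widetilde J,\widetilde R,\widetilde B$ of the system transformed via $(\varphi,U)$, and the discrete gradient pair scheme applied to the original system with $(\overline E,\overline z),\overline J,\overline R,\overline B$ is equivalent, up to the change of variables $\varphi$, to the discrete gradient pair scheme applied to the transformed system with $(\widehat E,\hat z),\widehat J,\widehat R,\widehat B$. That is, for every $h>0$, $N\in\mathbb N$, $\tilde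 x^0,\dots,\tilde x^N\in\widetilde{\mathcal X}$ and $u^{k,k+1},y^{k,k+1}\in\mathbb R^m$ ($k=0,\dots,N-1$), with $x^k=\varphi(\tilde x^k)$: the sequence $x^0$, $(x^{k+1},u^{k,k+1},y^{k,k+1})_{k=0}^{N-1}$ is a solution of the scheme for the original system if and only if $\tilde x^0$, $(\tilde x^{k+1},u^{k,k+1},y^{k,k+1})_{k=0}^{N-1}$ is a solution of the scheme for the transformed system.
   Context: A pHDAE on $\mathcal X$ is a system $E(x)\dot x=(J(x)-R(x))z(x)+B(x)u$, $y=B(x)^\top z(x)$ with Hamiltonian $\mathcal H\in C^1(\mathcal X,\mathbb R)$, where $E,J,R\in C(\mathcal X,\mathbb R^{n,n})$, $B\in C(\mathcal X,\mathbb R^{n,m})$, $z\in C(\mathcal X,\mathbb R^n)$, $J=-J^\top$, $R=R^\top\succeq0$ pointwise, and $(E,z)$ is a gradient pair for $\mathcal H$, i.e. $E(x)^\top z(x)=\nabla\mathcal H(x)$ for all $x\in\mathcal X$. A discrete gradient pair for $(\mathcal H,E,z)$ is $(\overline E,\overline z)\in C(\mathcal X\times\mathcal X,\mathbb R^{n,n})\times C(\mathcal X\times\mathcal X,\mathbb R^n)$ with $\overline z(x,x')^\top\overline E(x,x')(x'-x)=\mathcal H(x')-\mathcal H(x)$ for all $x,x'$, and $\overline E(x,x)=E(x)$, $\overline z(x,x)=z(x)$ for all $x$. A continuous $\overline F$ on $\mathcal X\times\mathcal X$ is a consistent approximation of $F$ on $\mathcal X$ if $\overline F(x,x)=F(x)$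 for all $x$. A discrete Jacobian of $F\in C^1(\mathcal Y,\mathbb R^p)$, $\mathcal Y\subseteq\mathbb R^d$ open, is $\overline{\mathrm D}F\in C(\mathcal Y\times\mathcal Y,\mathbb R^{p,d})$ with $\overline{\mathrm D}F(x,x')(x'-x)=F(x')-F(x)$ and $\overline{\mathrm D}F(x,x)=\mathrm DF(x)$. An invertible system transformation is $(\varphi,U)$ with $\varphi\in C^1(\widetilde{\mathcal X},\mathcal X)$ a diffeomorphism between open subsets of $\mathbb R^n$ and $U\in C(\widetilde{\mathcal X},\mathbb R^{n,n})$ pointwise invertible. The system transformed via $(\varphi,U)$ is the pHDAE on $\widetilde{\mathcal X}$ with coefficients $\widetilde E=U^\top(E\circ\varphi)\mathrm D\varphi$, $\widetilde J=U^\top(J\circ\varphi)U$, $\widetilde R=U^\top(R\circ\varphi)U$, $\widetilde B=U^\top(B\circ\varphi)$, $\tilde z=U^{-1}(z\circ\varphi)$ and Hamiltonian $\widetilde{\mathcal H}=\mathcal H\circ\varphi$. The discrete gradient pair scheme with time step $h>0$ for a pHDAE with discrete gradient pair $(\overline E,\overline z)$ and consistent approximations $\overline J,\overline R,\overline B$ is, for $k=0,\dots,N-1$, $$\overline E(x^k,x^{k+1})(x^{k+1}-x^k)=h\big(\overline J(x^k,x^{k+1})-\overline R(x^k,x^{k+1})\big)\overline z(x^k,x^{k+1})+h\overline B(x^k,x^{k+1})u^{k,k+1},\quad y^{k,k+1}=\overline B(x^k,x^{k+1})^\top\overline z(x^k,x^{k+1}).$$ *)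

theory Defs
  imports "HOL-Analysis.Analysis"
begin

section \<open>Matrices and continuously differentiable maps\<close>

definition skew_symmetric :: "real ^ 'n ^ 'n \<Rightarrow> bool" where
  "skew_symmetric A \<longleftrightarrow> A = - transpose A"

definition sym_pos_semidef :: "real ^ 'n ^ 'n \<Rightarrow> bool" where
  "sym_pos_semidef A \<longleftrightarrow> A = transpose A \<and> (\<forall>v. 0 \<le> v \<bullet> (A *v v))"

text \<open>The derivative is continuous with respect to the operator norm.\<close>

definition C1_on :: "'a::real_normed_vector set \<Rightarrow> ('a \<Rightarrow> 'b::real_normed_vector) \<Rightarrow> bool" where
  "C1_on S f \<longleftrightarrow> (\<exists>f' :: 'a \<Rightarrow> 'a \<Rightarrow>\<^sub>L 'b.
     (\<forall>x\<in>S. (f has_derivative blinfun_apply (f' x)) (at x)) \<and> continuous_on S f')"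

definition C1_diffeomorphism ::
  "(real ^ 'n) set \<Rightarrow> (real ^ 'n) set \<Rightarrow> (real ^ 'n \<Rightarrow> real ^ 'n) \<Rightarrow> bool" where
  "C1_diffeomorphism S T \<phi> \<longleftrightarrow>
     open S \<and> open T \<and> bij_betw \<phi> S T \<and> C1_on S \<phi> \<and> C1_on T (inv_into S \<phi>)"


section \<open>Port-Hamiltonian descriptor systems\<close>

record ('n::finite, 'm::finite) phsys =
  cE :: "real ^ 'n \<Rightarrow> real ^ 'n ^ 'n"
  cJ :: "real ^ 'n \<Rightarrow> real ^ 'n ^ 'n"
  cR :: "real ^ 'n \<Rightarrow> real ^ 'n ^ 'n"
  cB :: "real ^ 'n \<Rightarrow> real ^ 'm ^ 'n"
  cz :: "real ^ 'n \<Rightarrow> real ^ 'n"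
  ham :: "real ^ 'n \<Rightarrow> real"

text \<open>\<open>GDERIV f x :> D\<close> says that the gradient of \<open>f\<close> at \<open>x\<close> is \<open>D\<close>.\<close>

definition gradient_pair ::
  "(real ^ 'n) set \<Rightarrow> (real ^ 'n \<Rightarrow> real) \<Rightarrow> (real ^ 'n \<Rightarrow> real ^ 'n ^ 'n)
    \<Rightarrow> (real ^ 'n \<Rightarrow> real ^ 'n) \<Rightarrow> bool" where
  "gradient_pair X H E z \<longleftrightarrow> (\<forall>x\<in>X. GDERIV H x :> (transpose (E x) *v z x))"

definition pHDAE :: "(real ^ 'n) set \<Rightarrow> ('n::finite, 'm::finite) phsys \<Rightarrow> bool" where
  "pHDAE X S \<longleftrightarrow>
     open X \<and> C1_on X (ham S) \<and>
     continuous_on X (cE S) \<and> continuous_on X (cJ S) \<and> continuous_on X (cR S) \<and>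
     continuous_on X (cB S) \<and> continuous_on X (cz S) \<and>
     (\<forall>x\<in>X. skew_symmetric (cJ S x)) \<and> (\<forall>x\<in>X. sym_pos_semidef (cR S x)) \<and>
     gradient_pair X (ham S) (cE S) (cz S)"

definition invertible_transformation ::
  "(real ^ 'n) set \<Rightarrow> (real ^ 'n) set \<Rightarrow> (real ^ 'n \<Rightarrow> real ^ 'n)
    \<Rightarrow> (real ^ 'n \<Rightarrow> real ^ 'n ^ 'n) \<Rightarrow> bool" where
  "invertible_transformation Xt X \<phi> U \<longleftrightarrow>
     C1_diffeomorphism Xt X \<phi> \<and> continuous_on Xt U \<and> (\<forall>x\<in>Xt. invertible (U x))"

definition transformed_system ::
  "(real ^ 'n \<Rightarrow> real ^ 'n) \<Rightarrow> (real ^ 'n \<Rightarrow> real ^ 'n ^ 'n)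
    \<Rightarrow> ('n::finite, 'm::finite) phsys \<Rightarrow> ('n::finite, 'm::finite) phsys" where
  "transformed_system \<phi> U S = \<lparr>
     cE = (\<lambda>x. transpose (U x) ** cE S (\<phi> x) ** jacobian \<phi> (at x)),
     cJ = (\<lambda>x. transpose (U x) ** cJ S (\<phi> x) ** U x),
     cR = (\<lambda>x. transpose (U x) ** cR S (\<phi> x) ** U x),
     cB = (\<lambda>x. transpose (U x) ** cB S (\<phi> x)),
     cz = (\<lambda>x. matrix_inv (U x) *v cz S (\<phi> x)),
     ham = ham S \<circ> \<phi> \<rparr>"


section \<open>Discrete gradient pair schemes\<close>

definition consistent_approximation ::
  "'a::topological_space set \<Rightarrow> ('a \<Rightarrow> 'b::topological_space) \<Rightarrow> ('a \<times> 'a \<Rightarrow> 'b) \<Rightarrow> bool" where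
  "consistent_approximation X F Fb \<longleftrightarrow>
     continuous_on (X \<times> X) Fb \<and> (\<forall>x\<in>X. Fb (x, x) = F x)"

definition discrete_gradient_pair ::
  "(real ^ 'n) set \<Rightarrow> (real ^ 'n \<Rightarrow> real) \<Rightarrow> (real ^ 'n \<Rightarrow> real ^ 'n ^ 'n)
    \<Rightarrow> (real ^ 'n \<Rightarrow> real ^ 'n)
    \<Rightarrow> ((real ^ 'n) \<times> (real ^ 'n) \<Rightarrow> real ^ 'n ^ 'n)
    \<Rightarrow> ((real ^ 'n) \<times> (real ^ 'n) \<Rightarrow> real ^ 'n) \<Rightarrow> bool" where
  "discrete_gradient_pair X H E z Eb zb \<longleftrightarrow>
     continuous_on (X \<times> X) Eb \<and> continuous_on (X \<times> X) zb \<and>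
     (\<forall>x\<in>X. \<forall>x'\<in>X. zb (x, x') \<bullet> (Eb (x, x') *v (x' - x)) = H x' - H x) \<and>
     (\<forall>x\<in>X. Eb (x, x) = E x) \<and> (\<forall>x\<in>X. zb (x, x) = z x)"

definition discrete_jacobian ::
  "(real ^ 'd) set \<Rightarrow> (real ^ 'd \<Rightarrow> real ^ 'p)
    \<Rightarrow> ((real ^ 'd) \<times> (real ^ 'd) \<Rightarrow> real ^ 'd ^ 'p) \<Rightarrow> bool" where
  "discrete_jacobian Y F DF \<longleftrightarrow>
     continuous_on (Y \<times> Y) DF \<and>
     (\<forall>x\<in>Y. \<forall>x'\<in>Y. DF (x, x') *v (x' - x) = F x' - F x) \<and>
     (\<forall>x\<in>Y. DF (x, x) = jacobian F (at x))"

record ('n::finite, 'm::finite) discretization =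
  dE :: "(real ^ 'n) \<times> (real ^ 'n) \<Rightarrow> real ^ 'n ^ 'n"
  dJ :: "(real ^ 'n) \<times> (real ^ 'n) \<Rightarrow> real ^ 'n ^ 'n"
  dR :: "(real ^ 'n) \<times> (real ^ 'n) \<Rightarrow> real ^ 'n ^ 'n"
  dB :: "(real ^ 'n) \<times> (real ^ 'n) \<Rightarrow> real ^ 'm ^ 'n"
  dz :: "(real ^ 'n) \<times> (real ^ 'n) \<Rightarrow> real ^ 'n"

definition transformed_discretization ::
  "(real ^ 'n \<Rightarrow> real ^ 'n) \<Rightarrow> ((real ^ 'n) \<times> (real ^ 'n) \<Rightarrow> real ^ 'n ^ 'n)
    \<Rightarrow> ((real ^ 'n) \<times> (real ^ 'n) \<Rightarrow> real ^ 'n ^ 'n)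
    \<Rightarrow> ('n::finite, 'm::finite) discretization \<Rightarrow> ('n::finite, 'm::finite) discretization" where
  "transformed_discretization \<phi> D\<phi> Ub D = \<lparr>
     dE = (\<lambda>(x, x'). transpose (Ub (x, x')) ** dE D (\<phi> x, \<phi> x') ** D\<phi> (x, x')),
     dJ = (\<lambda>(x, x'). transpose (Ub (x, x')) ** dJ D (\<phi> x, \<phi> x') ** Ub (x, x')),
     dR = (\<lambda>(x, x'). transpose (Ub (x, x')) ** dR D (\<phi> x, \<phi> x') ** Ub (x, x')),
     dB = (\<lambda>(x, x'). transpose (Ub (x, x')) ** dB D (\<phi> x, \<phi> x')),
     dz = (\<lambda>(x, x'). matrix_inv (Ub (x, x')) *v dz D (\<phi> x, \<phi> x')) \<rparr>"

text \<open>
  Only the entries \<open>x 0, \<dots>, x N\<close>, \<open>u 0, \<dots>, u (N - 1)\<close> and \<open>y 0, \<dots>, y (N - 1)\<close> matter;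
  \<open>u k\<close> and \<open>y k\<close> stand for the input and output on the step from \<open>x k\<close> to \<open>x (k + 1)\<close>.
\<close>

definition scheme_solution ::
  "(real ^ 'n) set \<Rightarrow> ('n::finite, 'm::finite) discretization \<Rightarrow> real \<Rightarrow> nat
    \<Rightarrow> (nat \<Rightarrow> real ^ 'n) \<Rightarrow> (nat \<Rightarrow> real ^ 'm) \<Rightarrow> (nat \<Rightarrow> real ^ 'm) \<Rightarrow> bool" where
  "scheme_solution X D h N x u y \<longleftrightarrow>
     (\<forall>k\<le>N. x k \<in> X) \<and>
     (\<forall>k<N.
        dE D (x k, x (Suc k)) *v (x (Suc k) - x k)
          = h *\<^sub>R ((dJ D (x k, x (Suc k)) - dR D (x k, x (Suc k))) *v dz D (x k, x (Suc k)))
            + h *\<^sub>R (dB D (x k, x (Suc k)) *v u k) \<and>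
        y k = transpose (dB D (x k, x (Suc k))) *v dz D (x k, x (Suc k)))"

end

(* On the discrete level the transformation acts like the continuous one: the discrete Jacobian
   turns x' - x into phi x' - phi x, and the factor Ub^T multiplying the whole step equation is
   invertible, hence cancels, while Ub and its inverse cancel in front of z.
   On the diagonal the formulas reduce to those of the transformed system. *)

theory Submission
  imports Defs
begin

section \<open>Matrix algebra\<close>

lemma matrix_inv_right_cancel:
  fixes A :: "real ^ 'n ^ 'n"
  assumes "invertible A"
  shows "A *v (matrix_inv A *v v) = v"
proof -
  \<comment> \<open>\<open>matrix_inv\<close> is a Hilbert choice, so its defining equations become
    available only once invertibility exhibits some two-sided inverse.\<close>
  have "A ** matrix_inv A = mat 1"
    using assms someI_ex[of "\<lambda>B. A ** B = mat 1 \<and> B ** A = mat 1"]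
    unfolding invertible_def matrix_inv_def by blast
  then show ?thesis
    by (simp add: matrix_vector_mul_assoc)
qed

lemma matrix_vector_mult_eq_iff:
  fixes A :: "real ^ 'n ^ 'n"
  assumes "invertible A"
  shows "A *v v = A *v w \<longleftrightarrow> v = w"
  using inj_matrix_vector_mult[OF assms] by (rule inj_eq)

text \<open>Used to move a factor of a product to the other side of an inner product. The simp rule
  \<open>transpose_matrix_vector\<close> must be off then: it would first turn
  \<open>transpose A *v w\<close> into \<open>w v* A\<close>.\<close>

lemma inner_transpose_mult:
  fixes A :: "real ^ 'm ^ 'n"
  shows "v \<bullet> (transpose A *v w) = (A *v v) \<bullet> w"
  by (metis dot_lmul_matrix inner_commute transpose_matrix_vector)

lemma matrix_mult_uminus_right:
  fixes A :: "real ^ 'm ^ 'n" and B :: "real ^ 'p ^ 'm"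
  shows "A ** (- B) = - (A ** B)"
  by (simp add: matrix_matrix_mult_def vec_eq_iff sum_negf)

lemma matrix_mult_uminus_left:
  fixes A :: "real ^ 'm ^ 'n" and B :: "real ^ 'p ^ 'm"
  shows "(- A) ** B = - (A ** B)"
  by (simp add: matrix_matrix_mult_def vec_eq_iff sum_negf)

text \<open>Transposing the triple product reproduces the outer factors and transposes only
  \<open>A\<close>, so the sign can be pulled through them.\<close>

lemma skew_symmetric_congruence:
  assumes "skew_symmetric A"
  shows "skew_symmetric (transpose V ** A ** V)"
proof -
  have "transpose (transpose V ** A ** V) = transpose V ** transpose A ** V"
    by (simp add: matrix_transpose_mul matrix_mul_assoc)
  moreover have "A = - transpose A"
    using assms by (simp add: skew_symmetric_def)
  ultimately show ?thesis
    unfolding skew_symmetric_def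
    by (metis matrix_mult_uminus_left matrix_mult_uminus_right)
qed

text \<open>The quadratic form of the new matrix at \<open>v\<close> is that of \<open>A\<close> at
  \<open>V *v v\<close>, hence nonnegative.\<close>

lemma sym_pos_semidef_congruence:
  assumes "sym_pos_semidef A"
  shows "sym_pos_semidef (transpose V ** A ** V)"
  unfolding sym_pos_semidef_def
proof (intro conjI allI)
  have "transpose A = A"
    using assms by (simp add: sym_pos_semidef_def)
  then show "transpose V ** A ** V = transpose (transpose V ** A ** V)"
    by (simp add: matrix_transpose_mul matrix_mul_assoc)
next
  fix v
  have "v \<bullet> ((transpose V ** A ** V) *v v) = (V *v v) \<bullet> (A *v (V *v v))"
    by (simp add: inner_transpose_mult del: transpose_matrix_vector flip: matrix_vector_mul_assoc)
  then show "0 \<le> v \<bullet> ((transpose V ** A ** V) *v v)"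
    using assms by (simp add: sym_pos_semidef_def)
qed


section \<open>Continuity and differentiability\<close>

lemma continuous_on_matrix_mult:
  fixes A :: "'a::topological_space \<Rightarrow> real ^ 'm ^ 'n" and B :: "'a \<Rightarrow> real ^ 'p ^ 'm"
  assumes "continuous_on S A" "continuous_on S B"
  shows "continuous_on S (\<lambda>x. A x ** B x)"
  unfolding matrix_matrix_mult_def by (intro continuous_intros assms)

lemma continuous_on_transpose:
  fixes A :: "'a::topological_space \<Rightarrow> real ^ 'm ^ 'n"
  assumes "continuous_on S A"
  shows "continuous_on S (\<lambda>x. transpose (A x))"
  unfolding transpose_def by (intro continuous_intros assms)

text \<open>The Leibniz formula is polynomial in the entries. Continuity is assumed entrywise
  because the numerators in Cramer's rule have entries defined by cases on the column.\<close>

lemma continuous_on_det: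
  fixes A :: "'a::topological_space \<Rightarrow> real ^ 'n ^ 'n"
  assumes "\<And>i j. continuous_on S (\<lambda>x. A x $ i $ j)"
  shows "continuous_on S (\<lambda>x. det (A x))"
  unfolding det_def by (intro continuous_intros assms)

text \<open>By Cramer's rule the solution of a linear system is a quotient of determinants.\<close>

lemma continuous_on_matrix_inv_mult:
  fixes A :: "'a::topological_space \<Rightarrow> real ^ 'n ^ 'n" and v :: "'a \<Rightarrow> real ^ 'n"
  assumes "continuous_on S A" "continuous_on S v" and inv: "\<And>x. x \<in> S \<Longrightarrow> invertible (A x)"
  shows "continuous_on S (\<lambda>x. matrix_inv (A x) *v v x)"
proof -
  define c where "c x = (\<chi> k. det (\<chi> i j. if j = k then v x $ i else A x $ i $ j) / det (A x))" for x
  have nz: "det (A x) \<noteq> 0" if "x \<in> S" for x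
    using inv[OF that] by (simp add: invertible_det_nz)
  have "continuous_on S c"
    unfolding c_def
  proof (intro continuous_on_vec_lambda continuous_on_divide continuous_on_det ballI nz)
    fix k i j :: 'n
    show "continuous_on S (\<lambda>x. (\<chi> i j. if j = k then v x $ i else A x $ i $ j) $ i $ j)"
      by (cases "j = k") (auto intro!: continuous_intros assms)
  qed (auto intro!: continuous_intros assms)
  \<comment> \<open>Cramer's rule says that \<open>c x\<close> is the only solution of the system
    with matrix \<open>A x\<close> and right-hand side \<open>v x\<close>, and the vector on the
    right is a solution.\<close>
  moreover have "c x = matrix_inv (A x) *v v x" if "x \<in> S" for x
    using cramer[OF nz[OF that], THEN iffD1, OF matrix_inv_right_cancel[OF inv[OF that]]]
    by (simp add: c_def)
  ultimately show ?thesis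
    by (rule continuous_on_eq)
qed

text \<open>Phrased with \<open>fst\<close> and \<open>snd\<close> to match the components of
  \<open>transformed_discretization\<close> after \<open>case_prod_unfold\<close>.\<close>

lemma continuous_on_compose_prod:
  assumes "continuous_on (X \<times> X) G" "continuous_on Y \<phi>" "\<phi> ` Y \<subseteq> X"
  shows "continuous_on (Y \<times> Y) (\<lambda>p. G (\<phi> (fst p), \<phi> (snd p)))"
proof (rule continuous_on_compose2[OF assms(1)])
  have "continuous_on (Y \<times> Y) (\<lambda>p. \<phi> (fst p))" "continuous_on (Y \<times> Y) (\<lambda>p. \<phi> (snd p))"
    by (auto intro!: continuous_on_compose2[OF assms(2)] continuous_intros)
  then show "continuous_on (Y \<times> Y) (\<lambda>p. (\<phi> (fst p), \<phi> (snd p)))"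
    by (rule continuous_on_Pair)
qed (use assms(3) in auto)

lemma C1_on_differentiable:
  assumes "C1_on S f" "x \<in> S"
  shows "f differentiable (at x)"
  using assms unfolding C1_on_def differentiable_def by blast

lemma C1_on_imp_continuous_on:
  assumes "C1_on S f"
  shows "continuous_on S f"
  using assms
  by (simp add: C1_on_differentiable continuous_at_imp_continuous_on differentiable_imp_continuous_within)

text \<open>The chain rule at the level of bounded operators: the new derivative is continuous
  because operator composition is bounded bilinear.\<close>

lemma C1_on_compose:
  assumes "C1_on S f" "C1_on T g" "f ` S \<subseteq> T"
  shows "C1_on S (g \<circ> f)"
proof -
  obtain f' where f': "\<And>x. x \<in> S \<Longrightarrow> (f has_derivative blinfun_apply (f' x)) (at x)" "continuous_on S f'"
    using assms(1) unfolding C1_on_def by blast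
  obtain g' where g': "\<And>x. x \<in> T \<Longrightarrow> (g has_derivative blinfun_apply (g' x)) (at x)" "continuous_on T g'"
    using assms(2) unfolding C1_on_def by blast
  have "((g \<circ> f) has_derivative blinfun_apply (g' (f x) o\<^sub>L f' x)) (at x)" if "x \<in> S" for x
  proof -
    have "f x \<in> T"
      using assms(3) that by blast
    then have "((g \<circ> f) has_derivative g' (f x) \<circ> f' x) (at x)"
      by (intro diff_chain_at f'(1) g'(1) that)
    moreover have "blinfun_apply (g' (f x) o\<^sub>L f' x) = g' (f x) \<circ> f' x"
      by (rule ext) simp
    ultimately show ?thesis
      by (simp only:)
  qed
  moreover have "continuous_on S (\<lambda>x. g' (f x) o\<^sub>L f' x)"
    by (intro bounded_bilinear.continuous_on[OF bounded_bilinear_blinfun_compose] f'(2)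
        continuous_on_compose2[OF g'(2) C1_on_imp_continuous_on[OF assms(1)] assms(3)])
  ultimately show ?thesis
    unfolding C1_on_def by (intro exI[of _ "\<lambda>x. g' (f x) o\<^sub>L f' x"] conjI ballI)
qed

text \<open>The chain rule gives the derivative as an inner product of the image under the Jacobian
  with \<open>D\<close>; taking the adjoint of the Jacobian turns this into a gradient.\<close>

lemma GDERIV_compose:
  fixes f :: "real ^ 'd \<Rightarrow> real ^ 'p"
  assumes "f differentiable (at x)" "GDERIV H (f x) :> D"
  shows "GDERIV (H \<circ> f) x :> (transpose (jacobian f (at x)) *v D)"
proof -
  have "((H \<circ> f) has_derivative (\<lambda>h. (jacobian f (at x) *v h) \<bullet> D)) (at x)"
    using diff_chain_at[of f _ x H] assms by (simp add: jacobian_works gderiv_def o_def)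
  then show ?thesis
    by (simp add: gderiv_def inner_transpose_mult del: transpose_matrix_vector)
qed


section \<open>Transformation of the system\<close>

lemma invertible_transformationD:
  assumes "invertible_transformation Xt X \<phi> U"
  shows "open Xt" "C1_on Xt \<phi>" "\<phi> ` Xt \<subseteq> X" "continuous_on Xt U" "\<And>x. x \<in> Xt \<Longrightarrow> invertible (U x)"
  using assms
  by (auto simp: invertible_transformation_def C1_diffeomorphism_def bij_betw_def)

text \<open>A discrete Jacobian restricted to the diagonal witnesses that the Jacobian is continuous.\<close>

lemma discrete_jacobian_continuous_jacobian:
  assumes "discrete_jacobian Y F DF"
  shows "continuous_on Y (\<lambda>x. jacobian F (at x))"
proof -
  have "continuous_on (Y \<times> Y) DF"
    using assms by (simp add: discrete_jacobian_def)
  then have "continuous_on Y (\<lambda>x. DF (x, x))"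
    by (rule continuous_on_compose2) (auto intro!: continuous_intros)
  moreover have "DF (x, x) = jacobian F (at x)" if "x \<in> Y" for x
    using assms that by (simp add: discrete_jacobian_def)
  ultimately show ?thesis
    by (rule continuous_on_eq)
qed

text \<open>\<open>C1_on\<close> provides a continuous operator-valued derivative, whereas
  \<open>cE\<close> contains the Jacobian matrix; the continuity of the latter enters as a
  hypothesis.\<close>

lemma pHDAE_transformed_system:
  assumes S: "pHDAE X S" and T: "invertible_transformation Xt X \<phi> U"
    and J: "continuous_on Xt (\<lambda>x. jacobian \<phi> (at x))"
  shows "pHDAE Xt (transformed_system \<phi> U S)"
proof -
  note T = invertible_transformationD[OF T]
  note comp = continuous_on_compose2[OF _ C1_on_imp_continuous_on[OF T(2)] T(3)]
  have c: "continuous_on Xt (\<lambda>x. cE S (\<phi> x))" "continuous_on Xt (\<lambda>x. cJ S (\<phi> x))"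
    "continuous_on Xt (\<lambda>x. cR S (\<phi> x))" "continuous_on Xt (\<lambda>x. cB S (\<phi> x))"
    "continuous_on Xt (\<lambda>x. cz S (\<phi> x))"
    using S by (simp_all add: pHDAE_def comp)
  have X: "\<phi> x \<in> X" if "x \<in> Xt" for x
    using T(3) that by blast
  \<comment> \<open>Transposing the new \<open>E\<close> puts \<open>U x\<close> directly in front
    of its inverse; what remains is the transposed Jacobian applied to the old gradient at
    \<open>\<phi> x\<close>.\<close>
  have grad: "GDERIV (ham S \<circ> \<phi>) x :>
      (transpose (transpose (U x) ** cE S (\<phi> x) ** jacobian \<phi> (at x)) *v (matrix_inv (U x) *v cz S (\<phi> x)))"
    if "x \<in> Xt" for x
  proof -
    have "GDERIV (ham S) (\<phi> x) :> (transpose (cE S (\<phi> x)) *v cz S (\<phi> x))"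
      using S X[OF that] by (simp add: pHDAE_def gradient_pair_def)
    from GDERIV_compose[OF C1_on_differentiable[OF T(2) that] this] show ?thesis
      by (simp add: matrix_transpose_mul matrix_inv_right_cancel[OF T(5)[OF that]]
          del: transpose_matrix_vector flip: matrix_vector_mul_assoc)
  qed
  show ?thesis
    unfolding pHDAE_def gradient_pair_def transformed_system_def phsys.simps
    using S X by (intro conjI ballI T(1,4,5) C1_on_compose[OF T(2) _ T(3)] continuous_on_matrix_mult
        continuous_on_transpose continuous_on_matrix_inv_mult J c
        skew_symmetric_congruence sym_pos_semidef_congruence grad) (simp_all add: pHDAE_def)
qed


section \<open>Transformation of the scheme\<close>

lemma discrete_gradient_pair_transformed:
  fixes S :: "('n::finite, 'm::finite) phsys" and D :: "('n, 'm) discretization"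
  assumes D: "discrete_gradient_pair X (ham S) (cE S) (cz S) (dE D) (dz D)"
    and \<phi>: "continuous_on Xt \<phi>" "\<phi> ` Xt \<subseteq> X"
    and J: "discrete_jacobian Xt \<phi> D\<phi>" and U: "consistent_approximation Xt U Ub"
    and inv: "\<forall>p \<in> Xt \<times> Xt. invertible (Ub p)"
  defines "St \<equiv> transformed_system \<phi> U S" and "Dh \<equiv> transformed_discretization \<phi> D\<phi> Ub D"
  shows "discrete_gradient_pair Xt (ham St) (cE St) (cz St) (dE Dh) (dz Dh)"
proof -
  have X: "\<phi> x \<in> X" if "x \<in> Xt" for x
    using \<phi>(2) that by blast
  \<comment> \<open>Moved across the inner product, \<open>transpose (Ub (x, x'))\<close> becomes
    \<open>Ub (x, x')\<close> and meets its inverse. This leaves the identity of the old pair at the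
    image points.\<close>
  have id: "(matrix_inv (Ub (x, x')) *v dz D (\<phi> x, \<phi> x')) \<bullet>
      ((transpose (Ub (x, x')) ** dE D (\<phi> x, \<phi> x') ** D\<phi> (x, x')) *v (x' - x))
      = ham S (\<phi> x') - ham S (\<phi> x)" if "x \<in> Xt" "x' \<in> Xt" for x x'
  proof -
    have "D\<phi> (x, x') *v (x' - x) = \<phi> x' - \<phi> x"
      using J that by (simp add: discrete_jacobian_def)
    moreover have "dz D (\<phi> x, \<phi> x') \<bullet> (dE D (\<phi> x, \<phi> x') *v (\<phi> x' - \<phi> x)) = ham S (\<phi> x') - ham S (\<phi> x)"
      using D X that by (simp add: discrete_gradient_pair_def)
    ultimately show ?thesis
      using inv that
      by (simp add: inner_transpose_mult matrix_inv_right_cancel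
          del: transpose_matrix_vector flip: matrix_vector_mul_assoc)
  qed
  show ?thesis
    using D J U inv id X unfolding discrete_gradient_pair_def consistent_approximation_def
      discrete_jacobian_def St_def Dh_def transformed_system_def transformed_discretization_def
    by (auto simp: case_prod_unfold intro!: continuous_on_matrix_mult continuous_on_transpose
        continuous_on_matrix_inv_mult continuous_on_compose_prod[OF _ \<phi>])
qed

lemma consistent_approximation_transformed:
  fixes S :: "('n::finite, 'm::finite) phsys" and D :: "('n, 'm) discretization"
    and D\<phi> :: "(real ^ 'n) \<times> (real ^ 'n) \<Rightarrow> real ^ 'n ^ 'n"
  assumes \<phi>: "continuous_on Xt \<phi>" "\<phi> ` Xt \<subseteq> X" and U: "consistent_approximation Xt U Ub"
  defines "St \<equiv> transformed_system \<phi> U S" and "Dh \<equiv> transformed_discretization \<phi> D\<phi> Ub D"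
  shows "consistent_approximation X (cJ S) (dJ D) \<Longrightarrow> consistent_approximation Xt (cJ St) (dJ Dh)"
    and "consistent_approximation X (cR S) (dR D) \<Longrightarrow> consistent_approximation Xt (cR St) (dR Dh)"
    and "consistent_approximation X (cB S) (dB D) \<Longrightarrow> consistent_approximation Xt (cB St) (dB Dh)"
  using U \<phi>(2) unfolding consistent_approximation_def St_def Dh_def
    transformed_system_def transformed_discretization_def
  by (auto simp: case_prod_unfold intro!: continuous_on_matrix_mult continuous_on_transpose
      continuous_on_compose_prod[OF _ \<phi>])

text \<open>The points \<open>xt k\<close> are assumed to lie in \<open>Xt\<close>, so the
  membership clauses hold on both sides and only the step and output equations are compared.\<close>

lemma scheme_solution_transformed:
  assumes J: "discrete_jacobian Xt \<phi> D\<phi>" and inv: "\<forall>p \<in> Xt \<times> Xt. invertible (Ub p)"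
    and \<phi>: "\<phi> ` Xt \<subseteq> X" and xt: "\<forall>k\<le>N. xt k \<in> Xt"
  shows "scheme_solution X D h N (\<lambda>k. \<phi> (xt k)) u y \<longleftrightarrow>
    scheme_solution Xt (transformed_discretization \<phi> D\<phi> Ub D) h N xt u y"
proof -
  define Dh where "Dh = transformed_discretization \<phi> D\<phi> Ub D"
  \<comment> \<open>Stated for arbitrary points and an arbitrary input \<open>w\<close>, so that
    simplification can instantiate it at every time step.\<close>
  have step: "(dE D (\<phi> x, \<phi> x') *v (\<phi> x' - \<phi> x)
        = h *\<^sub>R ((dJ D (\<phi> x, \<phi> x') - dR D (\<phi> x, \<phi> x')) *v dz D (\<phi> x, \<phi> x'))
          + h *\<^sub>R (dB D (\<phi> x, \<phi> x') *v w)) \<longleftrightarrow>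
      dE Dh (x, x') *v (x' - x)
        = h *\<^sub>R ((dJ Dh (x, x') - dR Dh (x, x')) *v dz Dh (x, x')) + h *\<^sub>R (dB Dh (x, x') *v w)"
    (is "?l = ?r \<longleftrightarrow> ?lh = ?rh")
    and out: "transpose (dB Dh (x, x')) *v dz Dh (x, x') = transpose (dB D (\<phi> x, \<phi> x')) *v dz D (\<phi> x, \<phi> x')"
    if "x \<in> Xt" "x' \<in> Xt" for x x' w
  proof -
    let ?V = "Ub (x, x')"
    have V: "invertible ?V"
      using inv that by blast
    note V' = matrix_inv_right_cancel[OF V]
    have "D\<phi> (x, x') *v (x' - x) = \<phi> x' - \<phi> x"
      using J that by (simp add: discrete_jacobian_def)
    then have "?lh = transpose ?V *v ?l"
      by (simp add: Dh_def transformed_discretization_def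
          del: transpose_matrix_vector flip: matrix_vector_mul_assoc)
    moreover have "?rh = transpose ?V *v ?r"
      by (simp add: Dh_def transformed_discretization_def V' matrix_vector_mult_diff_rdistrib
          matrix_vector_mult_diff_distrib matrix_vector_right_distrib matrix_vector_mult_scaleR
          del: transpose_matrix_vector flip: matrix_vector_mul_assoc)
    ultimately show "?l = ?r \<longleftrightarrow> ?lh = ?rh"
      using matrix_vector_mult_eq_iff[OF transpose_invertible[OF V]] by metis
    show "transpose (dB Dh (x, x')) *v dz Dh (x, x') = transpose (dB D (\<phi> x, \<phi> x')) *v dz D (\<phi> x, \<phi> x')"
      by (simp add: Dh_def transformed_discretization_def V' matrix_transpose_mul
          del: transpose_matrix_vector flip: matrix_vector_mul_assoc)
  qed
  \<comment> \<open>Both endpoints of a step are covered: \<open>k < N\<close> keeps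
    \<open>Suc k\<close> within the range up to \<open>N\<close>.\<close>
  have "xt k \<in> Xt \<and> xt (Suc k) \<in> Xt" if "k < N" for k
    using xt that by simp
  moreover have "\<phi> (xt k) \<in> X" if "k \<le> N" for k
    using \<phi> xt that by blast
  ultimately show ?thesis
    using xt unfolding scheme_solution_def Dh_def[symmetric] by (simp add: step out del: transpose_matrix_vector)
qed

theorem theorem5p8:
  fixes X Xt :: "(real ^ 'n) set"
    and S :: "('n::finite, 'm::finite) phsys"
    and D :: "('n::finite, 'm::finite) discretization"
    and \<phi> :: "real ^ 'n \<Rightarrow> real ^ 'n"
    and U :: "real ^ 'n \<Rightarrow> real ^ 'n ^ 'n"
    and D\<phi> Ub :: "(real ^ 'n) \<times> (real ^ 'n) \<Rightarrow> real ^ 'n ^ 'n"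
  assumes "pHDAE X S"
    and "discrete_gradient_pair X (ham S) (cE S) (cz S) (dE D) (dz D)"
    and "consistent_approximation X (cJ S) (dJ D)"
    and "consistent_approximation X (cR S) (dR D)"
    and "consistent_approximation X (cB S) (dB D)"
    and "\<forall>p \<in> X \<times> X. skew_symmetric (dJ D p)"
    and "\<forall>p \<in> X \<times> X. sym_pos_semidef (dR D p)"
    and "invertible_transformation Xt X \<phi> U"
    and "discrete_jacobian Xt \<phi> D\<phi>"
    and "consistent_approximation Xt U Ub"
    and "\<forall>p \<in> Xt \<times> Xt. invertible (Ub p)"
  defines "St \<equiv> transformed_system \<phi> U S"
    and "Dh \<equiv> transformed_discretization \<phi> D\<phi> Ub D"
  shows "pHDAE Xt St
    \<and> discrete_gradient_pair Xt (ham St) (cE St) (cz St) (dE Dh) (dz Dh)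
    \<and> consistent_approximation Xt (cJ St) (dJ Dh)
    \<and> consistent_approximation Xt (cR St) (dR Dh)
    \<and> consistent_approximation Xt (cB St) (dB Dh)
    \<and> (\<forall>(h::real) (N::nat) (xt :: nat \<Rightarrow> real ^ 'n) (u :: nat \<Rightarrow> real ^ 'm) (y :: nat \<Rightarrow> real ^ 'm).
          h > 0 \<longrightarrow> (\<forall>k\<le>N. xt k \<in> Xt) \<longrightarrow>
          (scheme_solution X D h N (\<lambda>k. \<phi> (xt k)) u y \<longleftrightarrow> scheme_solution Xt Dh h N xt u y))"
proof -
  note T = invertible_transformationD[OF assms(8)]
  note cont = C1_on_imp_continuous_on[OF T(2)]
  show ?thesis
    \<comment> \<open>The discrete Jacobian acts in two ways: its diagonal supplies the continuity
      of the Jacobian matrix, and its secant identity drives the discrete gradient and scheme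
      claims.\<close>
    unfolding St_def Dh_def
    by (intro conjI allI impI
        pHDAE_transformed_system[OF assms(1,8) discrete_jacobian_continuous_jacobian[OF assms(9)]]
        discrete_gradient_pair_transformed[OF assms(2) cont T(3) assms(9-11)]
        consistent_approximation_transformed[OF cont T(3) assms(10)] assms(3-5)
        scheme_solution_transformed[OF assms(9,11) T(3)]) blast
qed

end
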